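(* Let $v_1,\dots,v_k\in\mathbb{R}^k$ with $k\ge 2$ and let $B=(b_{ij})$ with $b_{ij}=\langle v_i,v_j\rangle$. Assume $K>0$ is a constant such that for every $n\in\mathbb{N}$ and every centered symmetric positive semidefinite matrix $A=(a_{ij})\in M_n(\mathbb{R})$, $$\max_{x_1,\dots,x_n\in S^{n-1}}\sum_{i,j=1}^n a_{ij}\langle x_i,x_j\rangle\le K\max_{\sigma:\{1,\dots,n\}\to\{1,\dots,k\}}\sum_{i,j=1}^n a_{ij}\langle v_{\sigma(i)},v_{\sigma(j)}\rangle.$$ Then $K\ge\frac{1}{C(B)}$.
   Context: A matrix $A=(a_{ij})$ is centered if $\sum_{i,j}a_{ij}=0$. $S^{n-1}$ is the unit sphere of $\mathbb{R}^n$. $\gamma_{k-1}$ is the standard Gaussian measure on $\mathbb{R}^{k-1}$. $C(B)$ is the maximum, over all partitions $\{A_1,\dots,A_k\}$ of $\mathbb{R}^{k-1}$ into measurable sets, of $\sum_{i,j=1}^k b_{ij}\langle z_i,z_j\rangle$ with $z_i=\int_{A_i}x\,d\gamma_{k-1}(x)$. *)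

theory Defs
  imports "HOL-Probability.Probability"
begin

(* The dimensions k, k - 1 and n occur in one statement and n is quantified inside a
   hypothesis, so R^d is the set of functions {..<d} -> real (this is also the space of the
   product measure on {..<d}), and indices run over 0, ..., d - 1. *)

definition euclid :: "nat \<Rightarrow> (nat \<Rightarrow> real) set" where
  "euclid d = ({..<d} \<rightarrow>\<^sub>E UNIV)"

definition inner_on :: "nat \<Rightarrow> (nat \<Rightarrow> real) \<Rightarrow> (nat \<Rightarrow> real) \<Rightarrow> real" where
  "inner_on d x y = (\<Sum>l<d. x l * y l)"

definition unit_sphere :: "nat \<Rightarrow> (nat \<Rightarrow> real) set" where
  "unit_sphere d = {x \<in> euclid d. L2_set x {..<d} = 1}"

(* An m x m matrix is a function of type nat => nat => real, of which only the entries with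
   both indices below m matter. *)

definition centered :: "nat \<Rightarrow> (nat \<Rightarrow> nat \<Rightarrow> real) \<Rightarrow> bool" where
  "centered m a \<longleftrightarrow> (\<Sum>i<m. \<Sum>j<m. a i j) = 0"

definition sym_psd :: "nat \<Rightarrow> (nat \<Rightarrow> nat \<Rightarrow> real) \<Rightarrow> bool" where
  "sym_psd m a \<longleftrightarrow>
     (\<forall>i<m. \<forall>j<m. a i j = a j i) \<and>
     (\<forall>t \<in> euclid m. 0 \<le> (\<Sum>i<m. \<Sum>j<m. a i j * t i * t j))"

definition gram_sum ::
    "nat \<Rightarrow> nat \<Rightarrow> (nat \<Rightarrow> nat \<Rightarrow> real) \<Rightarrow> (nat \<Rightarrow> nat \<Rightarrow> real) \<Rightarrow> real" where
  "gram_sum m d a x = (\<Sum>i<m. \<Sum>j<m. a i j * inner_on d (x i) (x j))"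

(* The supremum is a maximum: a continuous function on a compact set. *)

definition sphere_max :: "nat \<Rightarrow> (nat \<Rightarrow> nat \<Rightarrow> real) \<Rightarrow> real" where
  "sphere_max n a = (SUP x \<in> {..<n} \<rightarrow>\<^sub>E unit_sphere n. gram_sum n n a x)"

definition cluster_max ::
    "nat \<Rightarrow> nat \<Rightarrow> (nat \<Rightarrow> nat \<Rightarrow> real) \<Rightarrow> (nat \<Rightarrow> nat \<Rightarrow> real) \<Rightarrow> real" where
  "cluster_max n k a v =
     Max ((\<lambda>\<sigma>. gram_sum n k a (\<lambda>i. v (\<sigma> i))) ` ({..<n} \<rightarrow>\<^sub>E {..<k}))"

definition gauss :: "nat \<Rightarrow> (nat \<Rightarrow> real) measure" where
  "gauss d = (\<Pi>\<^sub>M l\<in>{..<d}. std_normal_distribution)"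

(* Partitions into k labelled measurable pieces, which may be empty. *)

definition measurable_partitions :: "nat \<Rightarrow> nat \<Rightarrow> (nat \<Rightarrow> (nat \<Rightarrow> real) set) set" where
  "measurable_partitions d k =
     {A. (\<forall>i<k. A i \<in> sets (gauss d)) \<and> disjoint_family_on A {..<k} \<and>
         (\<Union>i<k. A i) = euclid d}"

definition gauss_moment :: "nat \<Rightarrow> (nat \<Rightarrow> real) set \<Rightarrow> nat \<Rightarrow> real" where
  "gauss_moment d S = (\<lambda>l\<in>{..<d}. LINT x:S|gauss d. x l)"

(* For a Gram matrix b the supremum is a maximum.  Bounded sequences of moments have a limit
   point z attaining the supremum; for w_i = (sum over j of b_ij z_j), a partition on whose
   i-th piece <w_i, x> is the largest of the <w_j, x> attains it as well, by the
   Cauchy-Schwarz inequality for the form b. *)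

definition C_const :: "nat \<Rightarrow> (nat \<Rightarrow> nat \<Rightarrow> real) \<Rightarrow> real" where
  "C_const k b =
     (SUP A \<in> measurable_partitions (k - 1) k.
        gram_sum k (k - 1) b (\<lambda>i. gauss_moment (k - 1) (A i)))"

end

(* With gamma the Gaussian measure on R^m, m large, cut R^m into finitely many cells U_p, put
   c_p = int_{U_p} x dgamma and test the hypothesis on a_pq = <c_p, c_q>.

   The vectors c_p / |c_p| give a value of at least (sum_p |c_p|)^2 / m on the left, by comparing
   the trace and the Hilbert-Schmidt norm of the operator sum_p c_p (x) c_p / |c_p|.  If the cells
   are fine in direction, sum_p |c_p| is close to the Gaussian mean of |x|, which is
   (1 + o(1)) sqrt m.

   A map sigma on the right is a k-partition of R^m coarser than the cells, whose moments z_i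
   satisfy sum_ij b_ij <z_i, z_j> = sum_i <w_i, z_i> <= int max_i <w_i, x> dgamma(x) for
   w_i = sum_j b_ij z_j.  As sum_i z_i = 0, a rotation moves all z_i into R^(k-1), and there the
   partition by the largest <w_i, x> does at least as well because b is a Gram matrix.  So the
   right-hand side is at most K C(B), and 1 <= K C(B) in the limit. *)

theory Submission
  imports Defs
begin

section \<open>Integration against the Gaussian measure\<close>

lemma inner_on_cong: "(\<And>l. l < d \<Longrightarrow> x l = x' l) \<Longrightarrow> (\<And>l. l < d \<Longrightarrow> y l = y' l) \<Longrightarrow>
   inner_on d x y = inner_on d x' y'"
  by (simp add: inner_on_def)

lemma inner_on_sum_left: "inner_on d (\<lambda>l. \<Sum>i\<in>I. c i * u i l) x = (\<Sum>i\<in>I. c i * inner_on d (u i) x)"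
  unfolding inner_on_def sum_distrib_left sum_distrib_right
  by (subst sum.swap) (simp add: mult.assoc)

lemma inner_on_commute: "inner_on d x y = inner_on d y x"
  by (simp add: inner_on_def mult.commute)

interpretation std_normal: prob_space std_normal_distribution
  by (rule prob_space_normal_density) simp

interpretation std_normal_prod: product_sigma_finite "\<lambda>_::nat. std_normal_distribution"
  by standard

lemma space_gauss: "space (gauss d) = euclid d"
  by (simp add: gauss_def euclid_def space_PiM)

lemma sets_gauss [measurable_cong]: "sets (gauss d) = sets (\<Pi>\<^sub>M l\<in>{..<d}. borel)"
  unfolding gauss_def by (intro sets_PiM_cong) auto

lemma measurable_gauss_component:
  "l < d \<Longrightarrow> (\<lambda>x. x l) \<in> borel_measurable (gauss d)"
  by (subst measurable_cong_sets[OF sets_gauss refl]) (rule measurable_component_singleton, simp)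

lemma measurable_inner_on [measurable]: "inner_on d w \<in> borel_measurable (gauss d)"
  unfolding inner_on_def[abs_def] by (intro borel_measurable_sum borel_measurable_times measurable_gauss_component) auto

text \<open>A function of one coordinate is a product over all coordinates whose other factors are
  the constant 1; these integrate to 1.\<close>

lemma
  assumes "l < d" "integrable std_normal_distribution g"
  shows integrable_gauss_component: "integrable (gauss d) (\<lambda>x. g (x l) :: real)" (is ?A)
    and integral_gauss_component: "(\<integral>x. g (x l) \<partial>gauss d) = (\<integral>t. g t \<partial>std_normal_distribution)" (is ?B)
proof -
  define F where "F i = (if i = l then g else (\<lambda>_. 1))" for i
  have eq: "(\<Prod>i<d. F i (x i)) = g (x l)" for x
    using assms(1) unfolding F_def by (subst prod.remove[of _ l]) (auto intro: prod.neutral)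
  have *: "integrable std_normal_distribution (F i)" for i
    using assms(2) by (simp add: F_def)
  show ?A
    using std_normal_prod.product_integrable_prod[of "{..<d}" F, OF _ *] by (simp add: eq gauss_def)
  have "(\<integral>x. g (x l) \<partial>gauss d) = (\<Prod>i<d. integral\<^sup>L std_normal_distribution (F i))"
    using std_normal_prod.product_integral_prod[of "{..<d}" F, OF _ *] by (simp add: eq gauss_def)
  also have "\<dots> = (\<integral>t. g t \<partial>std_normal_distribution)"
    using assms(1) std_normal.prob_space unfolding F_def
    by (subst prod.remove[of _ l]) (auto intro!: prod.neutral)
  finally show ?B .
qed

lemma
  assumes "l < d" "l' < d" "l \<noteq> l'"
    and "integrable std_normal_distribution g" "integrable std_normal_distribution h"
  shows integrable_gauss_components: "integrable (gauss d) (\<lambda>x. g (x l) * h (x l') :: real)" (is ?A)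
    and integral_gauss_components: "(\<integral>x. g (x l) * h (x l') \<partial>gauss d) =
      (\<integral>t. g t \<partial>std_normal_distribution) * (\<integral>t. h t \<partial>std_normal_distribution)" (is ?B)
proof -
  define F where "F i = (if i = l then g else if i = l' then h else (\<lambda>_. 1))" for i
  have eq: "(\<Prod>i<d. F i (x i)) = g (x l) * h (x l')" for x
    using assms(1-3) unfolding F_def
    by (subst prod.remove[of _ l], simp, simp, subst prod.remove[of _ l']) (auto intro: prod.neutral)
  have *: "integrable std_normal_distribution (F i)" for i
    using assms(4,5) by (simp add: F_def)
  show ?A
    using std_normal_prod.product_integrable_prod[of "{..<d}" F, OF _ *] by (simp add: eq gauss_def)
  have "(\<integral>x. g (x l) * h (x l') \<partial>gauss d) = (\<Prod>i<d. integral\<^sup>L std_normal_distribution (F i))"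
    using std_normal_prod.product_integral_prod[of "{..<d}" F, OF _ *] by (simp add: eq gauss_def)
  also have "\<dots> = (\<integral>t. g t \<partial>std_normal_distribution) * (\<integral>t. h t \<partial>std_normal_distribution)"
    using assms(1-3) std_normal.prob_space unfolding F_def
    by (subst prod.remove[of _ l], simp, simp, subst prod.remove[of _ l']) (auto intro!: prod.neutral)
  finally show ?B .
qed

lemma integrable_gauss_coord: "l < d \<Longrightarrow> integrable (gauss d) (\<lambda>x. x l)"
  using integrable_gauss_component[of l d "\<lambda>t. t"] integrable_std_normal_distribution_moment[of 1] by simp

section \<open>Rotation invariance\<close>

text \<open>For fixed \<open>y\<close> the shear is a translation in \<open>x\<close>, under which
  Lebesgue measure is invariant.\<close>

lemma nn_integral_shear1:
  fixes f :: "real \<Rightarrow> real \<Rightarrow> ennreal"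
  assumes [measurable]: "case_prod f \<in> borel_measurable (borel \<Otimes>\<^sub>M borel)"
  shows "(\<integral>\<^sup>+y. \<integral>\<^sup>+x. f (x + a * y) y \<partial>lborel \<partial>lborel) = (\<integral>\<^sup>+y. \<integral>\<^sup>+x. f x y \<partial>lborel \<partial>lborel)"
proof (rule nn_integral_cong)
  fix y
  have [measurable]: "(\<lambda>x. f x y) \<in> borel_measurable borel"
    by measurable
  show "(\<integral>\<^sup>+x. f (x + a * y) y \<partial>lborel) = (\<integral>\<^sup>+x. f x y \<partial>lborel)"
    using nn_integral_real_affine[of "\<lambda>x. f x y" 1 "a * y"] by (simp add: add.commute)
qed

text \<open>Swapping the two integrals reduces this to the previous shear.\<close>

lemma nn_integral_shear2:
  fixes f :: "real \<Rightarrow> real \<Rightarrow> ennreal"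
  assumes [measurable]: "case_prod f \<in> borel_measurable (borel \<Otimes>\<^sub>M borel)"
  shows "(\<integral>\<^sup>+y. \<integral>\<^sup>+x. f x (y + a * x) \<partial>lborel \<partial>lborel) = (\<integral>\<^sup>+y. \<integral>\<^sup>+x. f x y \<partial>lborel \<partial>lborel)"
proof -
  have "(\<integral>\<^sup>+y. \<integral>\<^sup>+x. f x (y + a * x) \<partial>lborel \<partial>lborel) = (\<integral>\<^sup>+x. \<integral>\<^sup>+y. f x (y + a * x) \<partial>lborel \<partial>lborel)"
    by (rule lborel_pair.Fubini') measurable
  also have "\<dots> = (\<integral>\<^sup>+x. \<integral>\<^sup>+y. f x y \<partial>lborel \<partial>lborel)"
    by (rule nn_integral_shear1[of "\<lambda>y x. f x y"]) measurable
  also have "\<dots> = (\<integral>\<^sup>+y. \<integral>\<^sup>+x. f x y \<partial>lborel \<partial>lborel)"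
    by (rule lborel_pair.Fubini') measurable
  finally show ?thesis .
qed

text \<open>A plane rotation by an angle \<open>\<theta>\<close> with \<open>sin \<theta> \<noteq> 0\<close> is a product of three shears, with
  parameters \<open>- tan (\<theta>/2)\<close>, \<open>sin \<theta>\<close> and \<open>- tan (\<theta>/2)\<close>.\<close>

lemma nn_integral_rotation:
  fixes f :: "real \<Rightarrow> real \<Rightarrow> ennreal"
  assumes [measurable]: "case_prod f \<in> borel_measurable (borel \<Otimes>\<^sub>M borel)"
    and cs: "c\<^sup>2 + s\<^sup>2 = 1" "s \<noteq> 0"
  shows "(\<integral>\<^sup>+y. \<integral>\<^sup>+x. f (c * x - s * y) (s * x + c * y) \<partial>lborel \<partial>lborel) =
    (\<integral>\<^sup>+y. \<integral>\<^sup>+x. f x y \<partial>lborel \<partial>lborel)"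
proof -
  \<comment> \<open>For \<open>c = cos \<theta>\<close> and \<open>s = sin \<theta>\<close> this is
    \<open>- tan (\<theta> / 2)\<close>.\<close>
  define t where "t = (c - 1) / s"
  have ts: "t * s = c - 1"
    using cs by (simp add: t_def)
  have "s * (t * c + t) = s * (- s)"
  proof -
    have "s * (t * c + t) = (t * s) * c + t * s"
      by (simp add: algebra_simps)
    also have "\<dots> = c\<^sup>2 - 1"
      unfolding ts by (simp add: algebra_simps power2_eq_square)
    finally show ?thesis
      using cs(1) by (simp add: power2_eq_square)
  qed
  then have tc: "t * c + t = - s"
    using cs(2) by (metis mult_left_cancel)
  \<comment> \<open>\<open>e1\<close> and \<open>e2\<close> say that the three shears, applied one
    after the other, give the rotation.\<close>
  have e1: "s * (x + t * y) + y = s * x + c * y" for x y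
  proof -
    have "s * (x + t * y) + y = s * x + (t * s) * y + y"
      by (simp add: algebra_simps)
    then show ?thesis
      unfolding ts by (simp add: algebra_simps)
  qed
  have e2: "x + t * y + t * (s * x + c * y) = c * x - s * y" for x y
  proof -
    have "x + t * y + t * (s * x + c * y) = x + (t * s) * x + (t * c + t) * y"
      by (simp add: algebra_simps)
    then show ?thesis
      unfolding ts tc by (simp add: algebra_simps)
  qed
  have "(\<integral>\<^sup>+y. \<integral>\<^sup>+x. f x y \<partial>lborel \<partial>lborel) = (\<integral>\<^sup>+y. \<integral>\<^sup>+x. f (x + t * y) y \<partial>lborel \<partial>lborel)"
    by (rule nn_integral_shear1[symmetric]) measurable
  also have "\<dots> = (\<integral>\<^sup>+y. \<integral>\<^sup>+x. f (x + t * (y + s * x)) (y + s * x) \<partial>lborel \<partial>lborel)"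
    by (rule nn_integral_shear2[symmetric, of "\<lambda>x y. f (x + t * y) y"]) measurable
  also have "\<dots> = (\<integral>\<^sup>+y. \<integral>\<^sup>+x. f (x + t * y + t * (y + s * (x + t * y))) (y + s * (x + t * y)) \<partial>lborel \<partial>lborel)"
    by (rule nn_integral_shear1[symmetric, of "\<lambda>x y. f (x + t * (y + s * x)) (y + s * x)"]) measurable
  finally show ?thesis
    using e1 e2 by (simp add: add.commute)
qed

text \<open>The product of the two normal densities depends only on the distance to the origin, so
  it can be absorbed into \<open>f\<close> before rotating Lebesgue measure.\<close>

lemma nn_integral_std_normal_rotation:
  fixes f :: "real \<Rightarrow> real \<Rightarrow> ennreal"
  assumes [measurable]: "case_prod f \<in> borel_measurable (borel \<Otimes>\<^sub>M borel)"
    and cs: "c\<^sup>2 + s\<^sup>2 = 1" "s \<noteq> 0"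
  shows "(\<integral>\<^sup>+y. \<integral>\<^sup>+x. f (c * x - s * y) (s * x + c * y) \<partial>std_normal_distribution \<partial>std_normal_distribution) =
    (\<integral>\<^sup>+y. \<integral>\<^sup>+x. f x y \<partial>std_normal_distribution \<partial>std_normal_distribution)"
proof -
  let ?n = "std_normal_density"
  have dens: "(\<integral>\<^sup>+y. \<integral>\<^sup>+x. g x y \<partial>std_normal_distribution \<partial>std_normal_distribution) =
    (\<integral>\<^sup>+y. \<integral>\<^sup>+x. ennreal (?n x * ?n y) * g x y \<partial>lborel \<partial>lborel)"
    if [measurable]: "case_prod g \<in> borel_measurable (borel \<Otimes>\<^sub>M borel)" for g :: "real \<Rightarrow> real \<Rightarrow> ennreal"
  proof -
    have "(\<integral>\<^sup>+y. \<integral>\<^sup>+x. g x y \<partial>std_normal_distribution \<partial>std_normal_distribution) =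
      (\<integral>\<^sup>+y. ?n y * (\<integral>\<^sup>+x. g x y \<partial>std_normal_distribution) \<partial>lborel)"
      by (rule nn_integral_density) measurable
    also have "\<dots> = (\<integral>\<^sup>+y. \<integral>\<^sup>+x. ennreal (?n x * ?n y) * g x y \<partial>lborel \<partial>lborel)"
    proof (rule nn_integral_cong)
      fix y
      have "(\<integral>\<^sup>+x. g x y \<partial>std_normal_distribution) = (\<integral>\<^sup>+x. ?n x * g x y \<partial>lborel)"
        by (rule nn_integral_density) measurable
      then have "?n y * (\<integral>\<^sup>+x. g x y \<partial>std_normal_distribution) = (\<integral>\<^sup>+x. ?n y * (?n x * g x y) \<partial>lborel)"
        by (simp add: nn_integral_cmult)
      then show "?n y * (\<integral>\<^sup>+x. g x y \<partial>std_normal_distribution) = (\<integral>\<^sup>+x. ennreal (?n x * ?n y) * g x y \<partial>lborel)"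
        by (simp add: ennreal_mult mult_ac)
    qed
    finally show ?thesis .
  qed
  have rad: "?n (c * x - s * y) * ?n (s * x + c * y) = ?n x * ?n y" for x y
  proof -
    have "(c * x - s * y)\<^sup>2 + (s * x + c * y)\<^sup>2 = (c\<^sup>2 + s\<^sup>2) * (x\<^sup>2 + y\<^sup>2)"
      by (simp add: power2_eq_square algebra_simps)
    then have *: "- (c * x - s * y)\<^sup>2 / 2 + - (s * x + c * y)\<^sup>2 / 2 = - x\<^sup>2 / 2 + - y\<^sup>2 / 2"
      using cs by simp
    show ?thesis
      unfolding std_normal_density_def
      using arg_cong[OF *, of exp] unfolding exp_add by simp
  qed
  show ?thesis
    using nn_integral_rotation[of "\<lambda>x y. ennreal (?n x * ?n y) * f x y" c s] cs
    by (simp add: dens rad)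
qed

section \<open>Isometries of Gaussian space from plane rotations\<close>

definition givens :: "nat \<Rightarrow> nat \<Rightarrow> real \<Rightarrow> real \<Rightarrow> (nat \<Rightarrow> real) \<Rightarrow> nat \<Rightarrow> real" where
  "givens p q c s x = x(p := c * x p - s * x q, q := s * x p + c * x q)"

text \<open>Linearity enters through finite sums: the last clause carries a vanishing sum of moments
  over to their images, and its empty sum sends the zero function to itself. \<open>T\<close> acts
  on all functions, so it applies to Gaussian points and to moment vectors alike.\<close>

definition gauss_isometry :: "nat \<Rightarrow> ((nat \<Rightarrow> real) \<Rightarrow> nat \<Rightarrow> real) \<Rightarrow> bool" where
  "gauss_isometry d T \<longleftrightarrow>
     T \<in> measurable (gauss d) (gauss d) \<and> distr (gauss d) (gauss d) T = gauss d \<and>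
     (\<forall>x y. inner_on d (T x) (T y) = inner_on d x y) \<and>
     (\<forall>(I :: nat set) u. T (\<lambda>l. \<Sum>i\<in>I. u i l) = (\<lambda>l. \<Sum>i\<in>I. T (u i) l))"

lemma gauss_isometry_id: "gauss_isometry d (\<lambda>x. x)"
  by (simp add: gauss_isometry_def)

lemma gauss_isometry_comp:
  assumes "gauss_isometry d T" "gauss_isometry d T'"
  shows "gauss_isometry d (\<lambda>x. T' (T x))"
proof -
  have [measurable]: "T \<in> measurable (gauss d) (gauss d)" "T' \<in> measurable (gauss d) (gauss d)"
    using assms by (auto simp: gauss_isometry_def)
  have "distr (gauss d) (gauss d) (\<lambda>x. T' (T x)) = distr (distr (gauss d) (gauss d) T) (gauss d) T'"
    by (subst distr_distr) (auto simp: comp_def)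
  then show ?thesis
    using assms by (simp add: gauss_isometry_def)
qed

lemma inner_on_givens:
  assumes "p < d" "q < d" "p \<noteq> q" "c\<^sup>2 + s\<^sup>2 = 1"
  shows "inner_on d (givens p q c s x) (givens p q c s y) = inner_on d x y"
proof -
  have split: "inner_on d u w = u p * w p + (u q * w q + (\<Sum>l\<in>{..<d} - {p} - {q}. u l * w l))" for u w
    unfolding inner_on_def using assms(1-3)
    by (subst sum.remove[of _ p], simp, simp, subst sum.remove[of _ q]) auto
  have "(c * x p - s * x q) * (c * y p - s * y q) + (s * x p + c * x q) * (s * y p + c * y q)
      = (c\<^sup>2 + s\<^sup>2) * (x p * y p) + (c\<^sup>2 + s\<^sup>2) * (x q * y q)"
    by (simp add: algebra_simps power2_eq_square)
  moreover have "(\<Sum>l\<in>{..<d} - {p} - {q}. givens p q c s x l * givens p q c s y l) =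
      (\<Sum>l\<in>{..<d} - {p} - {q}. x l * y l)"
    by (intro sum.cong) (auto simp: givens_def)
  ultimately show ?thesis
    using assms(3,4) by (simp add: split) (simp add: givens_def)
qed

lemma measurable_givens:
  assumes "p < d" "q < d"
  shows "givens p q c s \<in> measurable (gauss d) (gauss d)"
proof -
  have "(\<lambda>x. \<lambda>l\<in>{..<d}. givens p q c s x l) \<in> measurable (gauss d) (\<Pi>\<^sub>M l\<in>{..<d}. borel)"
  proof (rule measurable_restrict)
    fix l assume "l \<in> {..<d}"
    then show "(\<lambda>x. givens p q c s x l) \<in> borel_measurable (gauss d)"
      using assms measurable_gauss_component[of l d] measurable_gauss_component[of p d]
        measurable_gauss_component[of q d]
      by (cases "l = q"; cases "l = p") (simp_all add: givens_def)
  qed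
  \<comment> \<open>The rotation changes only coordinates below \<open>d\<close>, so on
    \<open>euclid d\<close> its result is already extensional and the restriction does
    nothing.\<close>
  also have "?this \<longleftrightarrow> givens p q c s \<in> measurable (gauss d) (\<Pi>\<^sub>M l\<in>{..<d}. borel)"
    using assms by (intro measurable_cong) (auto simp: space_gauss euclid_def givens_def fun_eq_iff PiE_def extensional_def)
  finally show ?thesis
    by (subst measurable_cong_sets[OF refl sets_gauss])
qed

text \<open>Fubini with the coordinates \<open>p\<close> and \<open>q\<close> innermost, where a
  plane rotation acts while the others stay fixed.\<close>

lemma nn_integral_gauss_pair:
  assumes "p < d" "q < d" "p \<noteq> q" and f: "f \<in> borel_measurable (gauss d)"
  shows "(\<integral>\<^sup>+x. f x \<partial>gauss d) =
    (\<integral>\<^sup>+x. \<integral>\<^sup>+v. \<integral>\<^sup>+u. f (x(q := v, p := u)) \<partial>std_normal_distribution \<partial>std_normal_distribution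
      \<partial>(\<Pi>\<^sub>M l\<in>{..<d} - {p} - {q}. std_normal_distribution))"
proof -
  define I where "I = {..<d} - {p} - {q}"
  have I: "finite I" "p \<notin> insert q I" "q \<notin> I" "{..<d} = insert p (insert q I)"
    using assms(1-3) by (auto simp: I_def)
  let ?N = "std_normal_distribution"
  have f' [measurable]: "f \<in> borel_measurable (\<Pi>\<^sub>M l\<in>insert p (insert q I). ?N)"
    using f by (simp add: gauss_def I)
  have "(\<integral>\<^sup>+x. f x \<partial>gauss d) = (\<integral>\<^sup>+x. \<integral>\<^sup>+u. f (x(p := u)) \<partial>?N \<partial>(\<Pi>\<^sub>M l\<in>insert q I. ?N))"
    unfolding gauss_def I(4) using I
    by (intro std_normal_prod.product_nn_integral_insert f') auto
  also have "\<dots> = (\<integral>\<^sup>+x. \<integral>\<^sup>+v. \<integral>\<^sup>+u. f (x(q := v, p := u)) \<partial>?N \<partial>?N \<partial>(\<Pi>\<^sub>M l\<in>I. ?N))"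
    using I by (intro std_normal_prod.product_nn_integral_insert) measurable
  finally show ?thesis
    by (simp add: I_def)
qed

text \<open>With the remaining coordinates frozen, the rotation acts on a standard Gaussian pair,
  and planar invariance applies to the indicator of the set.\<close>

lemma distr_givens:
  assumes "p < d" "q < d" "p \<noteq> q" "c\<^sup>2 + s\<^sup>2 = 1" "s \<noteq> 0"
  shows "distr (gauss d) (gauss d) (givens p q c s) = gauss d"
proof (rule measure_eqI)
  fix X assume "X \<in> sets (distr (gauss d) (gauss d) (givens p q c s))"
  then have X [measurable]: "X \<in> sets (gauss d)"
    by simp
  let ?N = "std_normal_distribution"
  let ?R = "givens p q c s"
  note R [measurable] = measurable_givens[OF assms(1,2), of c s]
  let ?f = "indicator X :: (nat \<Rightarrow> real) \<Rightarrow> ennreal"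
  define I where "I = {..<d} - {p} - {q}"
  have I: "insert p (insert q I) = {..<d}"
    using assms(1,2) by (auto simp: I_def)
  have "emeasure (distr (gauss d) (gauss d) ?R) X = (\<integral>\<^sup>+x. ?f x \<partial>distr (gauss d) (gauss d) ?R)"
    by simp
  also have "\<dots> = (\<integral>\<^sup>+x. ?f (?R x) \<partial>gauss d)"
    by (rule nn_integral_distr) measurable
  also have "\<dots> = (\<integral>\<^sup>+x. \<integral>\<^sup>+v. \<integral>\<^sup>+u. ?f (?R (x(q := v, p := u))) \<partial>?N \<partial>?N \<partial>(\<Pi>\<^sub>M l\<in>I. ?N))"
    unfolding I_def by (intro nn_integral_gauss_pair assms) measurable
  also have "\<dots> = (\<integral>\<^sup>+x. \<integral>\<^sup>+v. \<integral>\<^sup>+u. ?f (x(q := v, p := u)) \<partial>?N \<partial>?N \<partial>(\<Pi>\<^sub>M l\<in>I. ?N))"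
  proof (rule nn_integral_cong)
    fix x assume x: "x \<in> space (\<Pi>\<^sub>M l\<in>I. ?N)"
    have "(\<lambda>z. x(q := snd z, p := fst z)) \<in> measurable (borel \<Otimes>\<^sub>M borel) (\<Pi>\<^sub>M l\<in>{..<d}. borel)"
      unfolding I[symmetric]
      using x by (intro measurable_fun_upd[where J = "insert q I"] measurable_fun_upd[where J = I])
        (auto simp: space_PiM intro!: measurable_const)
    then have "(\<lambda>z. x(q := snd z, p := fst z)) \<in> measurable (borel \<Otimes>\<^sub>M borel) (gauss d)"
      by (subst measurable_cong_sets[OF refl sets_gauss])
    then have "(\<lambda>z. ?f (x(q := snd z, p := fst z))) \<in> borel_measurable (borel \<Otimes>\<^sub>M borel)"
      by (rule measurable_compose) measurable
    then have meas: "case_prod (\<lambda>u v. ?f (x(q := v, p := u))) \<in> borel_measurable (borel \<Otimes>\<^sub>M borel)"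
      by (simp add: case_prod_unfold)
    have "?R (x(q := v, p := u)) = x(q := s * u + c * v, p := c * u - s * v)" for u v
      using assms(3) by (auto simp: givens_def fun_eq_iff)
    then show "(\<integral>\<^sup>+v. \<integral>\<^sup>+u. ?f (?R (x(q := v, p := u))) \<partial>?N \<partial>?N) = (\<integral>\<^sup>+v. \<integral>\<^sup>+u. ?f (x(q := v, p := u)) \<partial>?N \<partial>?N)"
      using nn_integral_std_normal_rotation[OF meas assms(4,5)] by simp
  qed
  also have "\<dots> = (\<integral>\<^sup>+x. ?f x \<partial>gauss d)"
    unfolding I_def by (intro nn_integral_gauss_pair[symmetric] assms) measurable
  also have "\<dots> = emeasure (gauss d) X"
    by simp
  finally show "emeasure (distr (gauss d) (gauss d) ?R) X = emeasure (gauss d) X" .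
qed simp

lemma gauss_isometry_givens:
  assumes "p < d" "q < d" "p \<noteq> q" "c\<^sup>2 + s\<^sup>2 = 1" "s \<noteq> 0"
  shows "gauss_isometry d (givens p q c s)"
  unfolding gauss_isometry_def
  using measurable_givens[OF assms(1,2)] distr_givens[OF assms] inner_on_givens[OF assms(1-4)]
  by (auto simp: givens_def fun_eq_iff sum_distrib_left sum_subtractf sum.distrib)

text \<open>Isometries for later rows must preserve the earlier rows, which vanish from column \<open>i\<close> on.\<close>

lemma gauss_isometry_eliminate_row:
  assumes "j \<le> d"
  shows "\<exists>T. gauss_isometry d T \<and> (\<forall>l. i < l \<longrightarrow> l < j \<longrightarrow> T u l = 0) \<and>
    (\<forall>w. (\<forall>l. i \<le> l \<longrightarrow> l < d \<longrightarrow> w l = 0) \<longrightarrow> (\<forall>l<d. T w l = w l))"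
  using assms
proof (induction j)
  case 0
  show ?case
    using gauss_isometry_id[of d] by (intro exI[of _ "\<lambda>x. x"]) auto
next
  case (Suc j)
  then obtain T where T: "gauss_isometry d T" "\<forall>l. i < l \<longrightarrow> l < j \<longrightarrow> T u l = 0"
    "\<forall>w. (\<forall>l. i \<le> l \<longrightarrow> l < d \<longrightarrow> w l = 0) \<longrightarrow> (\<forall>l<d. T w l = w l)"
    by auto
  \<comment> \<open>If column \<open>j\<close> needs no elimination, \<open>T\<close> is kept.
    Otherwise \<open>T u j \<noteq> 0\<close> makes the sine of the next rotation nonzero.\<close>
  show ?case
  proof (cases "j \<le> i \<or> T u j = 0")
    case True
    then have "\<And>l. i < l \<Longrightarrow> l < Suc j \<Longrightarrow> T u l = 0"
      using T(2) less_Suc_eq by auto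
    with T show ?thesis
      by (intro exI[of _ T]) auto
  next
    case False
    then have ij: "i < d" "j < d" "i < j" "T u j \<noteq> 0"
      using Suc.prems by auto
    define r where "r = sqrt ((T u i)\<^sup>2 + (T u j)\<^sup>2)"
    have r2: "r\<^sup>2 = (T u i)\<^sup>2 + (T u j)\<^sup>2"
      by (simp add: r_def)
    have r: "r \<noteq> 0"
      using ij(4) r2 by (metis power2_less_0 sum_power2_eq_zero_iff zero_power2)
    \<comment> \<open>This rotation sends the pair \<open>(T u i, T u j)\<close> to
      \<open>(r, 0)\<close>.\<close>
    define R where "R = givens i j (T u i / r) (- T u j / r)"
    have "(T u i / r)\<^sup>2 + (- T u j / r)\<^sup>2 = 1"
      using r by (simp add: power_divide add_divide_distrib[symmetric] r2[symmetric])
    then have "gauss_isometry d R"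
      unfolding R_def using ij r by (intro gauss_isometry_givens) auto
    then have "gauss_isometry d (\<lambda>x. R (T x))"
      using T(1) by (rule gauss_isometry_comp[rotated])
    moreover have "R (T u) l = 0" if "i < l" "l < Suc j" for l
      using that T(2) r by (auto simp: R_def givens_def less_Suc_eq)
    \<comment> \<open>After \<open>T\<close>, such a \<open>w\<close> still has zero entries in the
      columns \<open>i\<close> and \<open>j\<close>, so the rotation fixes it.\<close>
    moreover have "R (T w) l = w l" if "\<forall>l. i \<le> l \<longrightarrow> l < d \<longrightarrow> w l = 0" "l < d" for w l
      using T(3)[rule_format, OF that(1)[rule_format]] that ij by (auto simp: R_def givens_def)
    ultimately show ?thesis
      by (intro exI[of _ "\<lambda>x. R (T x)"]) auto
  qed
qed

text \<open>Triangularization by rotations, as in a QR factorization. Each of the first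
  \<open>r\<close> rows vanishes from column \<open>r\<close> on, so eliminating row
  \<open>r\<close> leaves them unchanged.\<close>

lemma gauss_isometry_triangular:
  "\<exists>T. gauss_isometry d T \<and> (\<forall>i<r. \<forall>l. i < l \<longrightarrow> l < d \<longrightarrow> T (z i) l = 0)"
proof (induction r)
  case 0
  show ?case
    using gauss_isometry_id by auto
next
  case (Suc r)
  then obtain T where T: "gauss_isometry d T" "\<And>i l. i < r \<Longrightarrow> i < l \<Longrightarrow> l < d \<Longrightarrow> T (z i) l = 0"
    by auto
  obtain R where R: "gauss_isometry d R" "\<forall>l. r < l \<longrightarrow> l < d \<longrightarrow> R (T (z r)) l = 0"
    "\<forall>w. (\<forall>l. r \<le> l \<longrightarrow> l < d \<longrightarrow> w l = 0) \<longrightarrow> (\<forall>l<d. R w l = w l)"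
    using gauss_isometry_eliminate_row[OF order_refl[of d], of r "T (z r)"] by (elim exE conjE) simp
  have "R (T (z i)) l = 0" if "i < Suc r" "i < l" "l < d" for i l
  proof (cases "i = r")
    case False
    then have "i < r"
      using that by simp
    then show ?thesis
      using that T(2) R(3) by simp
  qed (use that R(2) in auto)
  then show ?case
    using gauss_isometry_comp[OF T(1) R(1)] by (intro exI[of _ "\<lambda>x. R (T x)"]) auto
qed

section \<open>Moments of cells and partitions\<close>

text \<open>Coordinates from \<open>d\<close> on are \<open>0\<close>, while those of \<^const>\<open>gauss_moment\<close> are undefined: the
  sum of the moments of all cells is then the zero function.\<close>

definition cell_moment :: "nat \<Rightarrow> ((nat \<Rightarrow> real) \<Rightarrow> nat) \<Rightarrow> nat \<Rightarrow> nat \<Rightarrow> real" where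
  "cell_moment d s i l = (if l < d then \<integral>x. (if s x = i then x l else 0) \<partial>gauss d else 0)"

lemma integrable_cell:
  assumes [measurable]: "s \<in> measurable (gauss d) (count_space UNIV)" and "l < d"
  shows "integrable (gauss d) (\<lambda>x. if s x = i then x l else 0 :: real)"
proof (rule Bochner_Integration.integrable_bound[OF integrable_gauss_coord[OF assms(2)]])
  note measurable_gauss_component[OF assms(2), measurable]
  show "(\<lambda>x. if s x = i then x l else 0 :: real) \<in> borel_measurable (gauss d)"
    by measurable
qed auto

lemma gauss_moment_cell:
  assumes "l < d"
  shows "gauss_moment d {x \<in> euclid d. s x = i} l = cell_moment d s i l"
  using assms unfolding gauss_moment_def cell_moment_def set_lebesgue_integral_def
  by (auto intro!: Bochner_Integration.integral_cong simp: space_gauss)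

text \<open>\<open>\<sigma>\<close> merges cells of \<open>f\<close>, and the moment of a union of
  disjoint cells is the sum of their moments.\<close>

lemma cell_moment_comp:
  assumes [measurable]: "f \<in> measurable (gauss d) (count_space UNIV)"
    and "\<And>x. x \<in> euclid d \<Longrightarrow> f x < n"
  shows "cell_moment d (\<lambda>x. \<sigma> (f x)) i l = (\<Sum>p<n. if \<sigma> p = i then cell_moment d f p l else 0)"
proof (cases "l < d")
  case True
  have "(\<integral>x. (if \<sigma> (f x) = i then x l else 0) \<partial>gauss d) =
      (\<integral>x. (\<Sum>p<n. if \<sigma> p = i then (if f x = p then x l else 0) else 0) \<partial>gauss d)"
  proof (rule Bochner_Integration.integral_cong[OF refl])
    fix x assume "x \<in> space (gauss d)"
    then have "f x < n"
      using assms(2) by (simp add: space_gauss)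
    have "(\<Sum>p<n. if \<sigma> p = i then (if f x = p then x l else 0) else 0) =
        (\<Sum>p<n. if p = f x then (if \<sigma> (f x) = i then x l else 0) else 0)"
      by (intro sum.cong) auto
    with \<open>f x < n\<close> show "(if \<sigma> (f x) = i then x l else 0) = (\<Sum>p<n. if \<sigma> p = i then (if f x = p then x l else 0) else 0)"
      by simp
  qed
  also have "\<dots> = (\<Sum>p<n. \<integral>x. (if \<sigma> p = i then (if f x = p then x l else 0) else 0) \<partial>gauss d)"
  proof (rule Bochner_Integration.integral_sum)
    fix p
    show "integrable (gauss d) (\<lambda>x. if \<sigma> p = i then (if f x = p then x l else 0) else 0)"
      using integrable_cell[OF assms(1) True] by (cases "\<sigma> p = i") simp_all
  qed
  also have "\<dots> = (\<Sum>p<n. if \<sigma> p = i then cell_moment d f p l else 0)"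
    using True by (intro sum.cong) (auto simp: cell_moment_def)
  finally show ?thesis
    using True by (simp add: cell_moment_def)
qed (auto simp: cell_moment_def intro: sum.neutral)

lemma integral_gauss_coord: "l < d \<Longrightarrow> (\<integral>x. x l \<partial>gauss d) = 0"
  using integral_gauss_component[of l d "\<lambda>t. t"] integrable_std_normal_distribution_moment[of 1]
    integral_std_normal_distribution_moment_odd[of 1] by simp

text \<open>Merging all cells into one leaves the mean of the Gaussian measure, which is
  zero.\<close>

lemma sum_cell_moment:
  assumes "f \<in> measurable (gauss d) (count_space UNIV)" "\<And>x. x \<in> euclid d \<Longrightarrow> f x < n"
  shows "(\<Sum>p<n. cell_moment d f p l) = 0"
  using cell_moment_comp[of f d n "\<lambda>_. 0" 0 l] assms integral_gauss_coord[of l d]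
  by (simp add: cell_moment_def split: if_splits)

text \<open>Pairing moments with the vectors \<open>w i\<close> amounts to integrating the linear
  function selected by the cell of each point. This makes a partition comparable with the pointwise
  maximum of the linear functions.\<close>

lemma
  assumes [measurable]: "s \<in> measurable (gauss d) (count_space UNIV)"
    and "\<And>x. x \<in> euclid d \<Longrightarrow> s x < n"
  shows integrable_inner_on_cell: "integrable (gauss d) (\<lambda>x. inner_on d (w (s x)) x)" (is ?A)
    and sum_inner_cell_moment:
      "(\<Sum>i<n. inner_on d (w i) (cell_moment d s i)) = (\<integral>x. inner_on d (w (s x)) x \<partial>gauss d)" (is ?B)
proof -
  have eq: "inner_on d (w (s x)) x = (\<Sum>i<n. \<Sum>l<d. w i l * (if s x = i then x l else 0))"
    if "x \<in> space (gauss d)" for x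
  proof -
    have "(\<Sum>i<n. \<Sum>l<d. w i l * (if s x = i then x l else 0)) = (\<Sum>i<n. if i = s x then inner_on d (w (s x)) x else 0)"
      by (intro sum.cong refl) (auto simp: inner_on_def)
    then show ?thesis
      using assms(2) that by (simp add: space_gauss)
  qed
  have int: "integrable (gauss d) (\<lambda>x. w i l * (if s x = i then x l else 0))" if "l < d" for i l
    by (intro integrable_mult_right integrable_cell assms that)
  have "?A \<longleftrightarrow> integrable (gauss d) (\<lambda>x. \<Sum>i<n. \<Sum>l<d. w i l * (if s x = i then x l else 0))"
    by (intro Bochner_Integration.integrable_cong eq refl)
  then show ?A
    using int by (auto intro!: Bochner_Integration.integrable_sum)
  have "(\<integral>x. inner_on d (w (s x)) x \<partial>gauss d) = (\<integral>x. (\<Sum>i<n. \<Sum>l<d. w i l * (if s x = i then x l else 0)) \<partial>gauss d)"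
    by (intro Bochner_Integration.integral_cong eq refl)
  also have "\<dots> = (\<Sum>i<n. \<integral>x. (\<Sum>l<d. w i l * (if s x = i then x l else 0)) \<partial>gauss d)"
    using int by (intro Bochner_Integration.integral_sum Bochner_Integration.integrable_sum) auto
  also have "\<dots> = (\<Sum>i<n. \<Sum>l<d. \<integral>x. w i l * (if s x = i then x l else 0) \<partial>gauss d)"
    using int by (intro sum.cong refl Bochner_Integration.integral_sum) auto
  also have "\<dots> = (\<Sum>i<n. inner_on d (w i) (cell_moment d s i))"
    by (simp add: inner_on_def cell_moment_def)
  finally show ?B ..
qed

text \<open>\<open>2 * \<bar>t\<bar> \<le> 1 + t * t\<close>, and the variance is 1.\<close>

lemma integral_abs_gauss_coord_le:
  assumes "l < d"
  shows "(\<integral>x. \<bar>x l\<bar> \<partial>gauss d) \<le> 1"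
proof -
  have 1: "integrable std_normal_distribution (\<lambda>t. 1 + t\<^sup>2)"
    using integrable_std_normal_distribution_moment[of 2] by simp
  have "(\<integral>x. \<bar>x l\<bar> \<partial>gauss d) \<le> (\<integral>x. (1 + (x l)\<^sup>2) / 2 \<partial>gauss d)"
  proof (rule integral_mono)
    show "integrable (gauss d) (\<lambda>x. (1 + (x l)\<^sup>2) / 2)"
      using integrable_gauss_component[OF assms 1] by simp
    show "\<bar>x l\<bar> \<le> (1 + (x l)\<^sup>2) / 2" for x :: "nat \<Rightarrow> real"
      using sum_squares_bound[of "\<bar>x l\<bar>" 1] by simp
  qed (use integrable_gauss_coord[OF assms] in simp)
  also have "\<dots> = 1"
    using integral_gauss_component[OF assms 1] std_normal_distribution_even_moments(1)[of 1]
      integrable_std_normal_distribution_moment[of 2] std_normal.prob_space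
    by simp
  finally show ?thesis .
qed

section \<open>Partitions in dimension k - 1 against C(B)\<close>

lemma abs_gauss_moment_le:
  assumes "l < d" "S \<in> sets (gauss d)"
  shows "\<bar>gauss_moment d S l\<bar> \<le> 1"
proof -
  have "\<bar>gauss_moment d S l\<bar> \<le> (\<integral>x. \<bar>indicator S x *\<^sub>R x l\<bar> \<partial>gauss d)"
    using assms by (simp add: gauss_moment_def set_lebesgue_integral_def)
  also have "\<dots> \<le> (\<integral>x. \<bar>x l\<bar> \<partial>gauss d)"
    using integrable_mult_indicator[OF assms(2) integrable_gauss_coord[OF assms(1)]]
      integrable_gauss_coord[OF assms(1)]
    by (intro integral_mono integrable_abs) (auto simp: indicator_def)
  also have "\<dots> \<le> 1"
    by (intro integral_abs_gauss_coord_le assms)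
  finally show ?thesis .
qed

text \<open>The level sets of \<open>s\<close> form an admissible partition. The supremum is over a
  bounded set because every coordinate of a moment is at most 1 in absolute value.\<close>

lemma gram_sum_cell_moment_le_C_const:
  assumes [measurable]: "s \<in> measurable (gauss (k - 1)) (count_space UNIV)"
    and s: "\<And>x. x \<in> euclid (k - 1) \<Longrightarrow> s x < k"
  shows "gram_sum k (k - 1) b (cell_moment (k - 1) s) \<le> C_const k b"
proof -
  let ?d = "k - 1"
  let ?F = "\<lambda>A. gram_sum k ?d b (\<lambda>i. gauss_moment ?d (A i))"
  define A where "A i = {x \<in> euclid ?d. s x = i}" for i
  have "A i \<in> sets (gauss ?d)" for i
    unfolding A_def space_gauss[symmetric] by measurable
  then have "A \<in> measurable_partitions ?d k"
    using s by (auto simp: measurable_partitions_def A_def disjoint_family_on_def)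
  moreover have "bdd_above (?F ` measurable_partitions ?d k)"
  proof (rule bdd_aboveI2)
    fix A assume A: "A \<in> measurable_partitions ?d k"
    show "?F A \<le> (\<Sum>i<k. \<Sum>j<k. \<bar>b i j\<bar> * (\<Sum>l<?d. 1))"
      unfolding gram_sum_def inner_on_def
    proof (intro sum_mono)
      fix i j assume "i \<in> {..<k}" "j \<in> {..<k}"
      then have "A i \<in> sets (gauss ?d)" "A j \<in> sets (gauss ?d)"
        using A by (auto simp: measurable_partitions_def)
      then have le: "\<bar>\<Sum>l<?d. gauss_moment ?d (A i) l * gauss_moment ?d (A j) l\<bar> \<le> (\<Sum>l<?d. 1)"
        by (intro order_trans[OF sum_abs] sum_mono)
          (auto simp: abs_mult intro!: mult_le_one abs_gauss_moment_le)
      have "c * X \<le> \<bar>c\<bar> * Y" if "\<bar>X\<bar> \<le> Y" for c X Y :: real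
        using order_trans[OF abs_ge_self[of "c * X"]] mult_left_mono[OF that abs_ge_zero[of c]]
        by (simp add: abs_mult)
      from this[OF le] show "b i j * (\<Sum>l<?d. gauss_moment ?d (A i) l * gauss_moment ?d (A j) l) \<le> \<bar>b i j\<bar> * (\<Sum>l<?d. 1)" .
    qed
  qed
  ultimately have "?F A \<le> C_const k b"
    unfolding C_const_def by (rule cSUP_upper)
  moreover have "?F A = gram_sum k ?d b (cell_moment ?d s)"
    unfolding gram_sum_def A_def
    by (intro sum.cong refl arg_cong2[of _ _ _ _ "(*)"] inner_on_cong gauss_moment_cell)
  ultimately show ?thesis
    by simp
qed

section \<open>Partitions by the largest inner product\<close>

definition max_inner :: "nat \<Rightarrow> nat \<Rightarrow> (nat \<Rightarrow> nat \<Rightarrow> real) \<Rightarrow> (nat \<Rightarrow> real) \<Rightarrow> real" where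
  "max_inner k d w x = Max ((\<lambda>i. inner_on d (w i) x) ` {..<k})"

lemma measurable_max_inner [measurable]: "max_inner k d w \<in> borel_measurable (gauss d)"
  unfolding max_inner_def[abs_def] by (intro borel_measurable_Max) auto

lemma inner_on_le_max_inner: "i < k \<Longrightarrow> inner_on d (w i) x \<le> max_inner k d w x"
  unfolding max_inner_def by (intro Max_ge) auto

text \<open>Taking the least index at which the maximum is attained makes the choice
  measurable.\<close>

lemma argmax_inner:
  assumes "k > 0"
  obtains s where "s \<in> measurable (gauss d) (count_space UNIV)" "\<And>x. s x < k"
    "\<And>x. inner_on d (w (s x)) x = max_inner k d w x"
proof -
  define P where "P x i \<longleftrightarrow> i < k \<and> (\<forall>j\<in>{..<k}. inner_on d (w j) x \<le> inner_on d (w i) x)" for x i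
  define s where "s x = (LEAST i. P x i)" for x
  have "Measurable.pred (gauss d) (\<lambda>x. inner_on d (w j) x \<le> inner_on d (w i) x)" for i j
    unfolding pred_def by (intro borel_measurable_le measurable_inner_on)
  then have "Measurable.pred (gauss d) (\<lambda>x. P x i)" for i
    unfolding P_def by (intro pred_intros_logic pred_intros_finite finite_lessThan) simp_all
  then have "s \<in> measurable (gauss d) (count_space UNIV)"
    unfolding s_def[abs_def] by (rule measurable_Least)
  moreover have P: "P x (s x)" for x
  proof -
    have "max_inner k d w x \<in> (\<lambda>i. inner_on d (w i) x) ` {..<k}"
      unfolding max_inner_def using assms by (intro Max_in) auto
    then obtain i where "i < k" "inner_on d (w i) x = max_inner k d w x"
      by auto
    then have "P x i"
      using inner_on_le_max_inner[of _ k d w x] by (auto simp: P_def)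
    then show ?thesis
      unfolding s_def by (rule LeastI)
  qed
  moreover have "inner_on d (w (s x)) x = max_inner k d w x" for x
  proof (rule antisym)
    show "max_inner k d w x \<le> inner_on d (w (s x)) x"
      unfolding max_inner_def using assms P[of x] by (intro Max.boundedI) (auto simp: P_def)
  qed (use P[of x] inner_on_le_max_inner[of "s x" k d w x] in \<open>auto simp: P_def\<close>)
  ultimately show thesis
    using that[of s] by (auto simp: P_def)
qed

lemma integrable_max_inner:
  assumes "k > 0"
  shows "integrable (gauss d) (max_inner k d w)"
proof -
  obtain s where s: "s \<in> measurable (gauss d) (count_space UNIV)" "\<And>x. s x < k"
    "\<And>x. inner_on d (w (s x)) x = max_inner k d w x"
    using argmax_inner[OF assms, of d w] by blast
  from integrable_inner_on_cell[OF s(1), of k w] s(2) have "integrable (gauss d) (\<lambda>x. inner_on d (w (s x)) x)"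
    by simp
  then show ?thesis
    by (simp add: s(3))
qed

lemma gauss_restrict:
  assumes "d \<le> m"
  shows "distr (gauss m) (gauss d) (\<lambda>x. restrict x {..<d}) = gauss d"
proof -
  interpret product_prob_space "\<lambda>_::nat. std_normal_distribution" "{..<m}"
    by standard
  show ?thesis
    using distr_restrict[of "{..<d}" "{..<m}"] assms by (simp add: gauss_def)
qed

section \<open>Gram forms as sums of squares\<close>

lemma sum_swap_pair:
  "(\<Sum>a\<in>A. \<Sum>i\<in>I. \<Sum>j\<in>J. f a i j) = (\<Sum>i\<in>I. \<Sum>j\<in>J. \<Sum>a\<in>A. f a i j)"
  by (subst sum.swap) (intro sum.cong refl sum.swap)

text \<open>Both sides are the squared Hilbert-Schmidt norm of the sum of the tensors of
  \<open>u i\<close> and \<open>y i\<close>. The identity serves for the form \<open>b\<close>, for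
  the bound on spheres, and for centering and positivity of the test matrix.\<close>

lemma sum_inner_times_inner:
  "(\<Sum>i<n. \<Sum>j<n. inner_on e (u i) (u j) * inner_on d (y i) (y j)) =
    (\<Sum>a<e. \<Sum>l<d. (\<Sum>i<n. u i a * y i l)\<^sup>2)"
proof -
  have "(\<Sum>a<e. \<Sum>l<d. (\<Sum>i<n. u i a * y i l)\<^sup>2) =
      (\<Sum>a<e. \<Sum>l<d. \<Sum>i<n. \<Sum>j<n. (u i a * u j a) * (y i l * y j l))"
    by (simp add: power2_eq_square sum_product mult_ac)
  also have "\<dots> = (\<Sum>i<n. \<Sum>j<n. \<Sum>a<e. \<Sum>l<d. (u i a * u j a) * (y i l * y j l))"
    unfolding sum_swap_pair[of _ "{..<n}" "{..<n}" "{..<d}"] by (rule sum_swap_pair)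
  finally show ?thesis
    by (simp add: inner_on_def sum_product)
qed

lemma gram_sum_gram:
  assumes "\<And>i j. i < k \<Longrightarrow> j < k \<Longrightarrow> b i j = inner_on e (v i) (v j)"
  shows "gram_sum k d b y = (\<Sum>a<e. \<Sum>l<d. (\<Sum>i<k. v i a * y i l)\<^sup>2)"
  using assms unfolding gram_sum_def sum_inner_times_inner[symmetric] by simp

text \<open>The form \<open>b\<close> is nonnegative at \<open>y - z\<close>, and its two cross
  terms agree by the symmetry of \<open>b\<close>.\<close>

lemma gram_sum_ge_linearization:
  assumes b: "\<And>i j. i < k \<Longrightarrow> j < k \<Longrightarrow> b i j = inner_on e (v i) (v j)"
  shows "2 * (\<Sum>i<k. \<Sum>j<k. b i j * inner_on d (z j) (y i)) \<le> gram_sum k d b z + gram_sum k d b y"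
proof -
  have nonneg: "0 \<le> gram_sum k d b (\<lambda>i l. y i l - z i l)"
    by (subst gram_sum_gram[of k b e v]) (auto intro!: sum_nonneg b)
  have eq: "inner_on d (\<lambda>l. y i l - z i l) (\<lambda>l. y j l - z j l) =
      inner_on d (y i) (y j) + inner_on d (z i) (z j) - inner_on d (z j) (y i) - inner_on d (z i) (y j)" for i j
    by (simp add: inner_on_def algebra_simps sum.distrib sum_subtractf)
  note nonneg
  also have "gram_sum k d b (\<lambda>i l. y i l - z i l) = gram_sum k d b y + gram_sum k d b z
      - (\<Sum>i<k. \<Sum>j<k. b i j * inner_on d (z j) (y i)) - (\<Sum>i<k. \<Sum>j<k. b i j * inner_on d (z i) (y j))"
    unfolding gram_sum_def eq by (simp add: algebra_simps sum.distrib sum_subtractf)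
  also have "(\<Sum>i<k. \<Sum>j<k. b i j * inner_on d (z i) (y j)) = (\<Sum>j<k. \<Sum>i<k. b i j * inner_on d (z i) (y j))"
    by (rule sum.swap)
  also have "\<dots> = (\<Sum>i<k. \<Sum>j<k. b i j * inner_on d (z j) (y i))"
    using b by (intro sum.cong refl) (simp add: inner_on_commute)
  finally show ?thesis
    by simp
qed

text \<open>Write Q for the Gram form and L for its linearization at the rotated moments
  \<open>z'\<close>. With \<open>y\<close> the moments of the partition of R^(k-1) by the largest of
  the rotated linear functions, Q(z) \<le> L(y) and 2 L(y) \<le> Q(z) + Q(y), hence Q(z) \<le>
  Q(y).\<close>

lemma gram_sum_cell_moment_le:
  assumes k: "k \<ge> 2" and b: "\<And>i j. i < k \<Longrightarrow> j < k \<Longrightarrow> b i j = inner_on e (v i) (v j)"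
    and m: "k - 1 \<le> m"
    and s [measurable]: "s \<in> measurable (gauss m) (count_space UNIV)"
    and sk: "\<And>x. x \<in> euclid m \<Longrightarrow> s x < k"
  shows "gram_sum k m b (cell_moment m s) \<le> C_const k b"
proof -
  define z where "z = cell_moment m s"
  obtain T where T: "gauss_isometry m T" and tri: "\<forall>i<k - 1. \<forall>l. i < l \<longrightarrow> l < m \<longrightarrow> T (z i) l = 0"
    using gauss_isometry_triangular[of m "k - 1" z] by blast
  define z' where "z' i = T (z i)" for i
  define w where "w i l = (\<Sum>j<k. b i j * z j l)" for i l
  \<comment> \<open>Formed from the rotated moments, so that \<open>w' i\<close> against
    \<open>T x\<close> has the same value as \<open>w i\<close> against \<open>x\<close> by
    preservation of inner products alone.\<close>
  define w' where "w' i l = (\<Sum>j<k. b i j * z' j l)" for i l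
  have T_meas [measurable]: "T \<in> measurable (gauss m) (gauss m)"
    and T_distr: "distr (gauss m) (gauss m) T = gauss m"
    and T_inner: "\<And>x y. inner_on m (T x) (T y) = inner_on m x y"
    and T_sum: "\<And>(I :: nat set) u. T (\<lambda>l. \<Sum>i\<in>I. u i l) = (\<lambda>l. \<Sum>i\<in>I. T (u i) l)"
    using T by (auto simp: gauss_isometry_def)
  \<comment> \<open>Triangularization covers the first \<open>k - 1\<close> moments. The last one is
    minus their sum, because all moments add up to zero, so it vanishes in the same columns.\<close>
  have z'_low: "z' i l = 0" if "i < k" "k - 1 \<le> l" "l < m" for i l
  proof -
    have low: "z' j l = 0" if "j < k - 1" for j
      using tri that \<open>k - 1 \<le> l\<close> \<open>l < m\<close> by (auto simp: z'_def)
    have "(\<lambda>l. \<Sum>j<k. z' j l) = T (\<lambda>l. \<Sum>j<k. z j l)"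
      by (simp add: T_sum z'_def)
    \<comment> \<open>The zero function is written as an empty sum, to which the additivity of
      \<open>T\<close> applies.\<close>
    also have "(\<lambda>l. \<Sum>j<k. z j l) = (\<lambda>l. \<Sum>j\<in>{}. z j l)"
      using sum_cell_moment[OF s sk] by (simp add: z_def)
    also have "T \<dots> = (\<lambda>l. 0)"
      unfolding T_sum by simp
    finally have "(\<Sum>j<k. z' j l) = 0"
      by metis
    moreover have "(\<Sum>j<k. z' j l) = z' (k - 1) l + (\<Sum>j<k - 1. z' j l)"
      using k by (cases k) auto
    ultimately have "z' (k - 1) l = 0"
      using low by simp
    with low[of i] that(1) show ?thesis
      by (cases "i = k - 1") auto
  qed
  have w'_low: "w' i l = 0" if "k - 1 \<le> l" "l < m" for i l
    unfolding w'_def using that by (auto intro!: sum.neutral z'_low)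
  have trunc: "inner_on m x y = inner_on (k - 1) x y" if "\<And>l. k - 1 \<le> l \<Longrightarrow> l < m \<Longrightarrow> x l = 0" for x y
    unfolding inner_on_def using that m by (intro sum.mono_neutral_right) auto
  obtain s' where s': "s' \<in> measurable (gauss (k - 1)) (count_space UNIV)" "\<And>x. s' x < k"
    "\<And>x. inner_on (k - 1) (w' (s' x)) x = max_inner k (k - 1) w' x"
    using argmax_inner[of k "k - 1" w'] k by auto
  define y where "y = cell_moment (k - 1) s'"

  have "gram_sum k m b z = (\<Sum>i<k. inner_on m (w i) (z i))"
    unfolding gram_sum_def w_def inner_on_sum_left by (simp add: inner_on_commute)
  also have "\<dots> = (\<integral>x. inner_on m (w (s x)) x \<partial>gauss m)"
    unfolding z_def by (rule sum_inner_cell_moment[OF s sk])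
  also have "\<dots> \<le> (\<integral>x. max_inner k m w x \<partial>gauss m)"
    using k by (intro integral_mono integrable_inner_on_cell[OF s sk] integrable_max_inner inner_on_le_max_inner sk)
      (auto simp: space_gauss)
  also have "\<dots> = (\<integral>x. max_inner k m w' (T x) \<partial>gauss m)"
    unfolding max_inner_def w_def w'_def inner_on_sum_left by (simp add: z'_def T_inner)
  also have "\<dots> = (\<integral>x. max_inner k m w' x \<partial>distr (gauss m) (gauss m) T)"
    by (rule integral_distr[symmetric]) measurable
  also have "\<dots> = (\<integral>x. max_inner k m w' x \<partial>gauss m)"
    by (simp add: T_distr)
  \<comment> \<open>\<open>w'\<close> vanishes from column \<open>k - 1\<close> on, so the integrand
    depends only on the first \<open>k - 1\<close> coordinates, whose law is
    \<open>gauss (k - 1)\<close>.\<close>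
  also have "\<dots> = (\<integral>x. max_inner k (k - 1) w' (restrict x {..<k - 1}) \<partial>gauss m)"
    unfolding max_inner_def using w'_low
    by (simp add: trunc) (simp add: inner_on_def)
  also have "\<dots> = (\<integral>x. max_inner k (k - 1) w' x \<partial>distr (gauss m) (gauss (k - 1)) (\<lambda>x. restrict x {..<k - 1}))"
  proof (rule integral_distr[symmetric])
    show "(\<lambda>x. restrict x {..<k - 1}) \<in> measurable (gauss m) (gauss (k - 1))"
      unfolding gauss_def using m by (intro measurable_restrict_subset) auto
  qed measurable
  also have "\<dots> = (\<integral>x. max_inner k (k - 1) w' x \<partial>gauss (k - 1))"
    using m by (simp add: gauss_restrict)
  also have "\<dots> = (\<Sum>i<k. inner_on (k - 1) (w' i) (y i))"
    unfolding y_def using s' sum_inner_cell_moment[OF s'(1), of k w'] by simp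
  also have "\<dots> = (\<Sum>i<k. \<Sum>j<k. b i j * inner_on (k - 1) (z' j) (y i))"
    unfolding w'_def inner_on_sum_left ..
  finally have "gram_sum k m b z \<le> (\<Sum>i<k. \<Sum>j<k. b i j * inner_on (k - 1) (z' j) (y i))" .
  moreover have "inner_on (k - 1) (z' i) (z' j) = inner_on m (z i) (z j)" if "i < k" for i j
    using trunc[of "z' i" "z' j"] z'_low[OF that] by (simp add: z'_def T_inner)
  then have "gram_sum k (k - 1) b z' = gram_sum k m b z"
    by (simp add: gram_sum_def)
  moreover have "gram_sum k (k - 1) b y \<le> C_const k b"
    unfolding y_def using s' by (intro gram_sum_cell_moment_le_C_const)
  moreover have "2 * (\<Sum>i<k. \<Sum>j<k. b i j * inner_on (k - 1) (z' j) (y i))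
      \<le> gram_sum k (k - 1) b z' + gram_sum k (k - 1) b y"
    by (rule gram_sum_ge_linearization) (rule b)
  ultimately show ?thesis
    by (simp add: z_def)
qed

section \<open>Discretization\<close>

lemma abs_inner_on_le_L2_set: "\<bar>inner_on d x y\<bar> \<le> L2_set x {..<d} * L2_set y {..<d}"
  unfolding inner_on_def
  by (rule order_trans[OF sum_abs]) (simp add: abs_mult L2_set_mult_ineq)

lemma inner_on_self: "inner_on d x x = (L2_set x {..<d})\<^sup>2"
  by (simp add: inner_on_def L2_set_def sum_nonneg power2_eq_square)

section \<open>Bounds for both sides of the hypothesis\<close>

lemma gram_sum_le_sphere_max:
  assumes "y \<in> {..<n} \<rightarrow>\<^sub>E unit_sphere n"
  shows "gram_sum n n a y \<le> sphere_max n a"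
  unfolding sphere_max_def
proof (rule cSUP_upper[OF assms bdd_aboveI2])
  fix x assume x: "x \<in> {..<n} \<rightarrow>\<^sub>E unit_sphere n"
  show "gram_sum n n a x \<le> (\<Sum>i<n. \<Sum>j<n. \<bar>a i j\<bar>)"
    unfolding gram_sum_def
  proof (intro sum_mono)
    fix i j assume "i \<in> {..<n}" "j \<in> {..<n}"
    then have "x i \<in> unit_sphere n" "x j \<in> unit_sphere n"
      using x by blast+
    then have "\<bar>inner_on n (x i) (x j)\<bar> \<le> 1"
      using abs_inner_on_le_L2_set[of n "x i" "x j"] by (simp add: unit_sphere_def)
    then have "\<bar>a i j * inner_on n (x i) (x j)\<bar> \<le> \<bar>a i j\<bar>"
      using mult_left_mono[of "\<bar>inner_on n (x i) (x j)\<bar>" 1 "\<bar>a i j\<bar>"] by (simp add: abs_mult)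
    then show "a i j * inner_on n (x i) (x j) \<le> \<bar>a i j\<bar>"
      by linarith
  qed
qed

text \<open>With \<open>y\<^sub>p = c\<^sub>p / \<bar>c\<^sub>p\<bar>\<close>, the quadratic form is the squared Hilbert-Schmidt norm of the
  operator \<open>\<Sum>\<^sub>p c\<^sub>p \<otimes> y\<^sub>p\<close> of rank at most \<open>m\<close>, whose trace is \<open>\<Sum>\<^sub>p \<bar>c\<^sub>p\<bar>\<close>.\<close>

lemma sphere_max_gram_ge:
  assumes "0 < m" "m \<le> n"
  shows "(\<Sum>p<n. L2_set (c p) {..<m})\<^sup>2 / m \<le> sphere_max n (\<lambda>p q. inner_on m (c p) (c q))"
proof -
  define L where "L p = L2_set (c p) {..<m}" for p
  \<comment> \<open>Unit vectors in \<open>n\<close> dimensions: the directions of the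
    \<open>c p\<close> padded with zeros, and the first basis vector where \<open>c p\<close> is
    zero.\<close>
  define y where "y = (\<lambda>p\<in>{..<n}. \<lambda>l\<in>{..<n}. if L p = 0 then if l = 0 then 1 else 0
      else if l < m then c p l / L p else 0)"
  have sphere: "y p \<in> unit_sphere n" if "p < n" for p
  proof -
    have "(\<Sum>l<n. (y p l)\<^sup>2) = 1"
    proof (cases "L p = 0")
      case True
      then have "(\<Sum>l<n. (y p l)\<^sup>2) = (\<Sum>l<n. if l = 0 then 1 else 0)"
        using that by (intro sum.cong) (auto simp: y_def)
      then show ?thesis
        using assms by simp
    next
      case False
      have "(\<Sum>l<n. (y p l)\<^sup>2) = (\<Sum>l<m. (y p l)\<^sup>2)"
        using assms that False by (intro sum.mono_neutral_right) (auto simp: y_def)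
      also have "\<dots> = (\<Sum>l<m. (c p l)\<^sup>2 / (L p)\<^sup>2)"
        using assms that False by (intro sum.cong) (auto simp: y_def power_divide)
      also have "\<dots> = 1"
        using False unfolding sum_divide_distrib[symmetric]
        by (simp add: L_def L2_set_def sum_nonneg)
      finally show ?thesis .
    qed
    then show ?thesis
      using that by (auto simp: unit_sphere_def L2_set_def euclid_def y_def)
  qed
  have diag: "(\<Sum>l<m. c p l * y p l) = L p" if "p < n" for p
  proof (cases "L p = 0")
    case True
    then show ?thesis
      by (simp add: L_def L2_set_eq_0_iff)
  next
    case False
    then have "(\<Sum>l<m. c p l * y p l) = inner_on m (c p) (c p) / L p"
      unfolding inner_on_def sum_divide_distrib using assms that
      by (intro sum.cong) (auto simp: y_def)
    with False show ?thesis
      by (simp add: inner_on_self L_def power2_eq_square)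
  qed
  \<comment> \<open>The sum of the norms is the trace; Cauchy-Schwarz over the \<open>m\<close>
    diagonal entries costs the factor \<open>m\<close>.\<close>
  have "(\<Sum>p<n. L p)\<^sup>2 = (\<Sum>l<m. \<Sum>p<n. c p l * y p l)\<^sup>2"
    by (subst sum.swap) (simp add: diag)
  also have "\<dots> \<le> (\<Sum>l<m. (\<Sum>p<n. c p l * y p l)\<^sup>2) * m"
    using sum_squared_le_sum_of_squares[of _ "{..<m}"] by simp
  \<comment> \<open>Each squared diagonal entry is one of the squared entries of its row.\<close>
  also have "\<dots> \<le> (\<Sum>a<m. \<Sum>l<n. (\<Sum>p<n. c p a * y p l)\<^sup>2) * m"
    using assms by (intro mult_right_mono sum_mono member_le_sum) auto
  also have "\<dots> = gram_sum n n (\<lambda>p q. inner_on m (c p) (c q)) y * m"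
    unfolding gram_sum_def by (simp add: sum_inner_times_inner)
  also have "\<dots> \<le> sphere_max n (\<lambda>p q. inner_on m (c p) (c q)) * m"
    using sphere by (intro mult_right_mono gram_sum_le_sphere_max) (auto simp: y_def)
  finally show ?thesis
    using assms by (simp add: L_def divide_le_eq)
qed

text \<open>A map \<open>\<sigma>\<close> assigns each point to one of \<open>k\<close> pieces
  through its cell. The moments of the pieces are sums of cell moments, and regrouping by the value
  of \<open>\<sigma>\<close> turns the clustering sum into the form \<open>b\<close> at these
  moments.\<close>

lemma cluster_max_cell_moment_le:
  assumes k: "k \<ge> 2" and b: "\<And>i j. i < k \<Longrightarrow> j < k \<Longrightarrow> b i j = inner_on k (v i) (v j)"
    and m: "k - 1 \<le> m"
    and f [measurable]: "f \<in> measurable (gauss m) (count_space UNIV)"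
    and fn: "\<And>x. x \<in> euclid m \<Longrightarrow> f x < n"
  shows "cluster_max n k (\<lambda>p q. inner_on m (cell_moment m f p) (cell_moment m f q)) v \<le> C_const k b"
proof -
  let ?c = "cell_moment m f"
  have bound: "gram_sum n k (\<lambda>p q. inner_on m (?c p) (?c q)) (\<lambda>i. v (\<sigma> i)) \<le> C_const k b"
    if \<sigma>: "\<sigma> \<in> {..<n} \<rightarrow>\<^sub>E {..<k}" for \<sigma>
  proof -
    let ?s = "\<lambda>x. \<sigma> (f x)"
    have inner: "(\<Sum>i<k. v i a * cell_moment m ?s i l) = (\<Sum>p<n. v (\<sigma> p) a * ?c p l)" for a l
    proof -
      have comp: "cell_moment m ?s i l = (\<Sum>p<n. if \<sigma> p = i then ?c p l else 0)" for i
        by (rule cell_moment_comp[OF f fn])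
      have "(\<Sum>i<k. v i a * cell_moment m ?s i l) =
          (\<Sum>i<k. \<Sum>p<n. if i = \<sigma> p then v (\<sigma> p) a * ?c p l else 0)"
        unfolding comp sum_distrib_left
        by (intro sum.cong refl) auto
      also have "\<dots> = (\<Sum>p<n. \<Sum>i<k. if i = \<sigma> p then v (\<sigma> p) a * ?c p l else 0)"
        by (rule sum.swap)
      also have "\<dots> = (\<Sum>p<n. v (\<sigma> p) a * ?c p l)"
        using \<sigma> by (intro sum.cong) (auto simp: PiE_def Pi_def)
      finally show ?thesis .
    qed
    have "gram_sum n k (\<lambda>p q. inner_on m (?c p) (?c q)) (\<lambda>i. v (\<sigma> i)) =
        (\<Sum>p<n. \<Sum>q<n. inner_on k (v (\<sigma> p)) (v (\<sigma> q)) * inner_on m (?c p) (?c q))"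
      by (simp add: gram_sum_def mult.commute)
    also have "\<dots> = (\<Sum>a<k. \<Sum>l<m. (\<Sum>i<k. v i a * cell_moment m ?s i l)\<^sup>2)"
      by (simp add: sum_inner_times_inner inner)
    also have "\<dots> = gram_sum k m b (cell_moment m ?s)"
      by (rule gram_sum_gram[symmetric]) (rule b)
    also have "\<dots> \<le> C_const k b"
    proof (rule gram_sum_cell_moment_le[OF k b m])
      show "\<And>x. x \<in> euclid m \<Longrightarrow> \<sigma> (f x) < k"
        using \<sigma> fn by (auto simp: PiE_def Pi_def)
    qed measurable
    finally show ?thesis .
  qed
  have "{..<n} \<rightarrow>\<^sub>E {..<k} \<noteq> {}"
    using k by (simp add: PiE_eq_empty_iff lessThan_empty_iff)
  then show ?thesis
    unfolding cluster_max_def using bound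
    by (intro Max.boundedI) (auto intro!: finite_imageI finite_PiE)
qed

text \<open>The sum of all entries is the squared norm of the sum of the \<open>c p\<close>, by the
  Hilbert-Schmidt identity with the one-dimensional vectors 1.\<close>

lemma centered_gram:
  assumes "\<And>l. l < m \<Longrightarrow> (\<Sum>p<n. c p l) = 0"
  shows "centered n (\<lambda>p q. inner_on m (c p) (c q))"
proof -
  have "(\<Sum>p<n. \<Sum>q<n. inner_on m (c p) (c q)) = (\<Sum>p<n. \<Sum>q<n. inner_on m (c p) (c q) * inner_on 1 (\<lambda>_. 1) (\<lambda>_. 1))"
    by (simp add: inner_on_def)
  also have "\<dots> = 0"
    unfolding sum_inner_times_inner using assms by simp
  finally show ?thesis
    by (simp add: centered_def)
qed

text \<open>The same identity with the one-dimensional vectors \<open>t p\<close> makes the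
  quadratic form a sum of squares.\<close>

lemma sym_psd_gram: "sym_psd n (\<lambda>p q. inner_on m (c p) (c q))"
proof -
  have "(\<Sum>p<n. \<Sum>q<n. inner_on m (c p) (c q) * t p * t q) =
      (\<Sum>p<n. \<Sum>q<n. inner_on m (c p) (c q) * inner_on 1 (\<lambda>_. t p) (\<lambda>_. t q))" for t
    by (simp add: inner_on_def mult.assoc)
  also have "\<dots> t \<ge> 0" for t
    unfolding sum_inner_times_inner by (intro sum_nonneg) auto
  finally show ?thesis
    by (simp add: sym_psd_def inner_on_commute)
qed

section \<open>The Gaussian mean of the norm\<close>

lemma sqrt_ge_quadratic:
  assumes "0 \<le> t"
  shows "(3 * t - t\<^sup>2) / 2 \<le> sqrt t"
proof -
  define u where "u = sqrt t"
  have u: "0 \<le> u" "t = u\<^sup>2"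
    using assms by (auto simp: u_def)
  \<comment> \<open>The cubic factor is \<open>u^3 - 3 * u + 2\<close>: the parabola touches the
    square root to first order at \<open>t = 1\<close>.\<close>
  have "0 \<le> u * ((u - 1)\<^sup>2 * (u + 2))"
    using u(1) by (intro mult_nonneg_nonneg) auto
  then show ?thesis
    unfolding u_def[symmetric] u(2) by (simp add: power2_eq_square algebra_simps)
qed

lemma integrable_L2_set_gauss: "integrable (gauss m) (\<lambda>x. L2_set x {..<m})"
proof (rule Bochner_Integration.integrable_bound)
  show "integrable (gauss m) (\<lambda>x. \<Sum>l<m. \<bar>x l\<bar>)"
    by (intro Bochner_Integration.integrable_sum integrable_abs integrable_gauss_coord) auto
  show "(\<lambda>x. L2_set x {..<m}) \<in> borel_measurable (gauss m)"
  proof -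
    have [measurable]: "(\<lambda>x. \<Sum>l<m. (x l)\<^sup>2) \<in> borel_measurable (gauss m)"
      by (intro borel_measurable_sum borel_measurable_power measurable_gauss_component) auto
    show ?thesis
      unfolding L2_set_def by measurable
  qed
  show "AE x in gauss m. norm (L2_set x {..<m}) \<le> norm (\<Sum>l<m. \<bar>x l\<bar>)"
    using L2_set_le_sum_abs by (auto intro!: AE_I2)
qed

text \<open>The quadratic lower bound for the square root is applied to \<open>t = S / m\<close>,
  where \<open>S\<close> is the squared norm. \<open>S\<close> has mean \<open>m\<close> and second
  moment \<open>m * m + 2 * m\<close>, so the bound integrates to \<open>1 - 1 / m\<close>.\<close>

lemma integral_L2_set_gauss_ge:
  assumes "0 < m"
  shows "sqrt m * (1 - 1 / m) \<le> (\<integral>x. L2_set x {..<m} \<partial>gauss m)"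
proof -
  let ?N = std_normal_distribution
  have i2: "integrable ?N (\<lambda>t. t\<^sup>2)" and i4: "integrable ?N (\<lambda>t. t\<^sup>2 * t\<^sup>2)"
    using integrable_std_normal_distribution_moment[of 2] integrable_std_normal_distribution_moment[of 4]
    by (simp_all add: power_add[symmetric])
  have m2: "(\<integral>t. t\<^sup>2 \<partial>?N) = 1" and m4: "(\<integral>t. t\<^sup>2 * t\<^sup>2 \<partial>?N) = 3"
    using std_normal_distribution_even_moments(1)[of 1] std_normal_distribution_even_moments(1)[of 2]
    by (simp_all add: power_add[symmetric] fact_numeral)
  have int2: "integrable (gauss m) (\<lambda>x. (x l)\<^sup>2)" "(\<integral>x. (x l)\<^sup>2 \<partial>gauss m) = 1" if "l < m" for l
    using integrable_gauss_component[OF that i2] integral_gauss_component[OF that i2] m2 by auto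
  \<comment> \<open>The diagonal terms are fourth moments, equal to 3; the others factor into second
    moments.\<close>
  have int4: "integrable (gauss m) (\<lambda>x. (x l)\<^sup>2 * (x j)\<^sup>2)"
    "(\<integral>x. (x l)\<^sup>2 * (x j)\<^sup>2 \<partial>gauss m) = 1 + (if j = l then 2 else 0)" if "l < m" "j < m" for l j
    using integrable_gauss_component[OF that(1) i4] integral_gauss_component[OF that(1) i4] m4
      integrable_gauss_components[OF that _ i2 i2] integral_gauss_components[OF that _ i2 i2] m2
    by (cases "l = j"; simp)+
  define S where "S x = (\<Sum>l<m. (x l)\<^sup>2)" for x :: "nat \<Rightarrow> real"
  have S2: "(S x)\<^sup>2 = (\<Sum>l<m. \<Sum>j<m. (x l)\<^sup>2 * (x j)\<^sup>2)" for x
    by (simp add: S_def power2_eq_square sum_product)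
  have intS: "integrable (gauss m) S" "(\<integral>x. S x \<partial>gauss m) = m"
    unfolding S_def using int2 by (auto simp: Bochner_Integration.integral_sum)
  have intS2: "integrable (gauss m) (\<lambda>x. (S x)\<^sup>2)"
    unfolding S2 using int4 by (intro Bochner_Integration.integrable_sum) auto
  have "(\<integral>x. (S x)\<^sup>2 \<partial>gauss m) = (\<Sum>l<m. \<integral>x. (\<Sum>j<m. (x l)\<^sup>2 * (x j)\<^sup>2) \<partial>gauss m)"
    unfolding S2 using int4
    by (intro Bochner_Integration.integral_sum Bochner_Integration.integrable_sum) auto
  also have "\<dots> = (\<Sum>l<m. \<Sum>j<m. \<integral>x. (x l)\<^sup>2 * (x j)\<^sup>2 \<partial>gauss m)"
    using int4 by (intro sum.cong refl Bochner_Integration.integral_sum) auto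
  also have "\<dots> = (\<Sum>l<m. \<Sum>j<m. 1 + (if j = l then 2 else 0))"
    using int4 by (intro sum.cong refl) auto
  also have "\<dots> = m * m + 2 * m"
    by (simp add: sum.distrib algebra_simps)
  finally have intS2': "(\<integral>x. (S x)\<^sup>2 \<partial>gauss m) = m * m + 2 * m" .
  have "sqrt m * (1 - 1 / m) = (\<integral>x. sqrt m * ((3 * (S x / m) - (S x)\<^sup>2 / (m * m)) / 2) \<partial>gauss m)"
    using intS intS2 intS2' assms by (simp add: field_simps)
  also have "\<dots> \<le> (\<integral>x. L2_set x {..<m} \<partial>gauss m)"
  proof (rule integral_mono)
    show "integrable (gauss m) (\<lambda>x. sqrt m * ((3 * (S x / m) - (S x)\<^sup>2 / (m * m)) / 2))"
      using intS intS2 by simp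
    fix x :: "nat \<Rightarrow> real"
    have "0 \<le> S x / m"
      by (simp add: S_def sum_nonneg)
    from sqrt_ge_quadratic[OF this]
    have "sqrt m * ((3 * (S x / m) - (S x)\<^sup>2 / (m * m)) / 2) \<le> sqrt m * sqrt (S x / m)"
      by (intro mult_left_mono) (auto simp: power_divide power2_eq_square[of "real m"])
    also have "\<dots> = L2_set x {..<m}"
      using assms by (simp add: L2_set_def S_def real_sqrt_divide)
    finally show "sqrt m * ((3 * (S x / m) - (S x)\<^sup>2 / (m * m)) / 2) \<le> L2_set x {..<m}" .
  qed (rule integrable_L2_set_gauss)
  finally show ?thesis .
qed

section \<open>Cells that are fine in direction\<close>

lemma measurable_map_list_countable:
  fixes g :: "'i \<Rightarrow> 'a \<Rightarrow> 'b :: countable"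
  assumes "\<And>i. i \<in> set is \<Longrightarrow> g i \<in> measurable M (count_space UNIV)"
  shows "(\<lambda>x. map (\<lambda>i. g i x) is) \<in> measurable M (count_space UNIV)"
  using assms
proof (induction "is")
  case (Cons i "is")
  have [measurable]: "g i \<in> measurable M (count_space UNIV)"
    "(\<lambda>x. map (\<lambda>i. g i x) is) \<in> measurable M (count_space UNIV)"
    using Cons by auto
  have "(\<lambda>x. (g i x, map (\<lambda>i. g i x) is)) \<in> measurable M (count_space UNIV \<Otimes>\<^sub>M count_space UNIV)"
    by measurable
  then have "(\<lambda>x. (\<lambda>(a, as). a # as) (g i x, map (\<lambda>i. g i x) is)) \<in> measurable M (count_space UNIV)"
    by (rule measurable_compose) (simp add: pair_measure_countable)
  then show ?case
    by simp
qed simp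

definition trunc_int :: "real \<Rightarrow> int" where
  "trunc_int t = (if 0 \<le> t then \<lfloor>t\<rfloor> else \<lceil>t\<rceil>)"

lemma trunc_int: "\<bar>real_of_int (trunc_int t)\<bar> \<le> \<bar>t\<bar>" "\<bar>real_of_int (trunc_int t) - t\<bar> \<le> 1"
  unfolding trunc_int_def by (auto split: if_split) linarith+

lemma measurable_trunc_int [measurable]: "trunc_int \<in> measurable borel (count_space UNIV)"
  unfolding trunc_int_def[abs_def] by measurable

text \<open>The cells group the points whose direction \<open>x / \<bar>x\<bar>\<close> has the same truncation to the grid of
  mesh \<open>1 / N\<close>. The truncation is towards zero so that grid points stay in the unit ball.\<close>

lemma exists_cells:
  fixes N m :: nat
  assumes "0 < N"
  obtains n f where "m \<le> n" "f \<in> measurable (gauss m) (count_space UNIV)" "\<And>x. f x < n"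
    "(\<integral>x. L2_set x {..<m} \<partial>gauss m) - m / N \<le> (\<Sum>p<n. L2_set (cell_moment m f p) {..<m})"
proof -
  define L where "L x = L2_set x {..<m}" for x :: "nat \<Rightarrow> real"
  \<comment> \<open>Where \<open>L x\<close> is 0, the quotient \<open>x l / L x\<close> is 0 by the
    convention on division by zero.\<close>
  define h where "h x l = trunc_int (N * (x l / L x))" for x l
  define g where "g x = map (h x) [0..<m]" for x
  define f where "f x = to_nat (g x)" for x
  \<comment> \<open>\<open>V p\<close> is the grid point coded by \<open>p\<close>, scaled back to a
    direction. Codes whose vector leaves the unit ball get 0 in \<open>W\<close>, so that
    \<open>W p\<close> has norm at most 1 for every \<open>p\<close>.\<close>
  define V where "V p l = real_of_int ((from_nat p :: int list) ! l) / N" for p l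
  define W where "W p = (if L2_set (V p) {..<m} \<le> 1 then V p else (\<lambda>_. 0))" for p
  have [measurable]: "L \<in> borel_measurable (gauss m)"
    using integrable_L2_set_gauss unfolding L_def[abs_def] by (rule borel_measurable_integrable)
  have h_meas: "(\<lambda>x. h x l) \<in> measurable (gauss m) (count_space UNIV)" if "l < m" for l
  proof -
    note measurable_gauss_component[OF that, measurable]
    show ?thesis
      unfolding h_def by measurable
  qed
  have "g \<in> measurable (gauss m) (count_space UNIV)"
    unfolding g_def[abs_def] by (intro measurable_map_list_countable h_meas) auto
  then have f_meas: "f \<in> measurable (gauss m) (count_space UNIV)"
    unfolding f_def[abs_def] by (rule measurable_compose) simp
  have dir: "\<bar>x l / L x\<bar> \<le> 1" if "l < m" for x l
    using member_le_L2_set[of "{..<m}" l "\<lambda>l. \<bar>x l\<bar>"] that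
    by (auto simp: L_def L2_set_def divide_le_eq_1)
  have h_le: "\<bar>h x l\<bar> \<le> N" if "l < m" for x l
  proof -
    have "\<bar>real_of_int (h x l)\<bar> \<le> \<bar>N * (x l / L x)\<bar>"
      unfolding h_def by (rule trunc_int)
    also have "\<dots> = N * \<bar>x l / L x\<bar>"
      by (simp add: abs_mult)
    also have "\<dots> \<le> real N * 1"
      using dir[OF that] by (intro mult_left_mono) auto
    finally show ?thesis
      by linarith
  qed
  define Y where "Y = {xs :: int list. set xs \<subseteq> {- int N..int N} \<and> length xs = m}"
  have "finite Y"
    unfolding Y_def by (rule finite_lists_length_eq) simp
  moreover have "g x \<in> Y" for x
    using h_le by (force simp: Y_def g_def abs_le_iff)
  ultimately have f_le: "f x \<le> Max (to_nat ` Y)" for x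
    unfolding f_def by (intro Max_ge) auto
  \<comment> \<open>The summand \<open>m\<close> adds empty cells to ensure
    \<open>m \<le> n\<close>.\<close>
  define n where "n = m + Suc (Max (to_nat ` Y))"
  have fn: "f x < n" for x
    using f_le[of x] by (simp add: n_def)
  have Vf: "V (f x) l = h x l / N" if "l < m" for x l
    using that by (simp add: V_def f_def g_def)
  have Wf: "W (f x) = V (f x)" for x
  proof -
    have "L2_set (V (f x)) {..<m} \<le> L2_set (\<lambda>l. \<bar>x l / L x\<bar>) {..<m}"
    proof -
      have "L2_set (V (f x)) {..<m} = L2_set (\<lambda>l. \<bar>V (f x) l\<bar>) {..<m}"
        by (simp add: L2_set_def)
      also have "\<dots> \<le> L2_set (\<lambda>l. \<bar>x l / L x\<bar>) {..<m}"
      proof (rule L2_set_mono)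
        fix l assume "l \<in> {..<m}"
        then have "\<bar>V (f x) l\<bar> = \<bar>real_of_int (h x l)\<bar> / N"
          by (simp add: Vf)
        also have "\<dots> \<le> \<bar>N * (x l / L x)\<bar> / N"
          unfolding h_def by (intro divide_right_mono trunc_int) auto
        also have "\<dots> = \<bar>x l / L x\<bar>"
          using assms by (simp add: abs_mult)
        finally show "\<bar>V (f x) l\<bar> \<le> \<bar>x l / L x\<bar>" .
      qed auto
      finally show ?thesis .
    qed
    also have "\<dots> = L2_set (\<lambda>l. x l * (1 / L x)) {..<m}"
      by (simp add: L2_set_def power_divide)
    also have "\<dots> = L x * (1 / L x)"
      by (subst L2_set_left_distrib[symmetric]) (auto simp: L_def)
    also have "\<dots> \<le> 1"
      by simp
    finally show ?thesis
      by (simp add: W_def)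
  qed
  \<comment> \<open>Each coordinate of the direction is off by at most \<open>1 / N\<close>, which
    costs at most \<open>\<bar>x l\<bar> / N\<close> in the inner product with
    \<open>x\<close>.\<close>
  have pointwise: "L x - (\<Sum>l<m. \<bar>x l\<bar> / N) \<le> inner_on m (W (f x)) x" for x
  proof -
    have "L x = inner_on m x x / L x"
      by (simp add: inner_on_self L_def power2_eq_square)
    then have "L x - (\<Sum>l<m. \<bar>x l\<bar> / N) = (\<Sum>l<m. x l / L x * x l - \<bar>x l\<bar> / N)"
      by (simp add: inner_on_def sum_subtractf sum_divide_distrib)
    also have "\<dots> \<le> (\<Sum>l<m. V (f x) l * x l)"
    proof (rule sum_mono)
      fix l assume "l \<in> {..<m}"
      then have "\<bar>x l / L x - V (f x) l\<bar> = \<bar>(h x l - N * (x l / L x)) / N\<bar>"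
        using assms by (simp add: Vf diff_divide_distrib abs_minus_commute)
      also have "\<dots> = \<bar>h x l - N * (x l / L x)\<bar> / N"
        by simp
      also have "\<dots> \<le> 1 / N"
        unfolding h_def by (intro divide_right_mono trunc_int) auto
      finally have "\<bar>x l / L x - V (f x) l\<bar> * \<bar>x l\<bar> \<le> 1 / N * \<bar>x l\<bar>"
        by (rule mult_right_mono) simp
      then have "(x l / L x - V (f x) l) * x l \<le> \<bar>x l\<bar> / N"
        using abs_ge_self[of "(x l / L x - V (f x) l) * x l"] by (simp add: abs_mult)
      then show "x l / L x * x l - \<bar>x l\<bar> / N \<le> V (f x) l * x l"
        by (simp add: left_diff_distrib)
    qed
    finally show ?thesis
      by (simp add: Wf inner_on_def)
  qed
  have int_abs: "integrable (gauss m) (\<lambda>x. \<bar>x l\<bar> / N)" if "l < m" for l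
    using integrable_gauss_coord[OF that] by simp
  have "(\<Sum>l<m. \<integral>x. \<bar>x l\<bar> / N \<partial>gauss m) \<le> (\<Sum>l<m. 1 / N)"
    using integral_abs_gauss_coord_le by (intro sum_mono) (auto intro: divide_right_mono)
  then have "(\<integral>x. L x \<partial>gauss m) - m / N \<le> (\<integral>x. L x \<partial>gauss m) - (\<Sum>l<m. \<integral>x. \<bar>x l\<bar> / N \<partial>gauss m)"
    by simp
  also have "\<dots> = (\<integral>x. L x - (\<Sum>l<m. \<bar>x l\<bar> / N) \<partial>gauss m)"
    using int_abs integrable_L2_set_gauss[of m] unfolding L_def
    by (subst Bochner_Integration.integral_diff) (auto simp: Bochner_Integration.integral_sum)
  also have "\<dots> \<le> (\<integral>x. inner_on m (W (f x)) x \<partial>gauss m)"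
    using int_abs integrable_L2_set_gauss[of m] fn f_meas pointwise
    by (intro integral_mono integrable_inner_on_cell[of f m n] Bochner_Integration.integrable_diff
        Bochner_Integration.integrable_sum) (auto simp: L_def)
  also have "\<dots> = (\<Sum>p<n. inner_on m (W p) (cell_moment m f p))"
    by (rule sum_inner_cell_moment[OF f_meas fn, symmetric])
  also have "\<dots> \<le> (\<Sum>p<n. L2_set (cell_moment m f p) {..<m})"
  proof (rule sum_mono)
    fix p
    have "inner_on m (W p) (cell_moment m f p) \<le> L2_set (W p) {..<m} * L2_set (cell_moment m f p) {..<m}"
      using abs_inner_on_le_L2_set[of m "W p" "cell_moment m f p"] by linarith
    also have "\<dots> \<le> 1 * L2_set (cell_moment m f p) {..<m}"
      by (intro mult_right_mono) (auto simp: W_def L2_set_0')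
    finally show "inner_on m (W p) (cell_moment m f p) \<le> L2_set (cell_moment m f p) {..<m}"
      by simp
  qed
  finally show thesis
    using that[of n f] f_meas fn by (simp add: n_def L_def)
qed

section \<open>The limit of large dimension\<close>

theorem theorem3p3:
  fixes k :: nat and v :: "nat \<Rightarrow> nat \<Rightarrow> real" and b :: "nat \<Rightarrow> nat \<Rightarrow> real" and K :: real
  assumes "k \<ge> 2"
    and "\<And>i. i < k \<Longrightarrow> v i \<in> euclid k"
    and "\<And>i j. i < k \<Longrightarrow> j < k \<Longrightarrow> b i j = inner_on k (v i) (v j)"
    and "K > 0"
    and "\<And>(n::nat) (a :: nat \<Rightarrow> nat \<Rightarrow> real).
           n \<ge> 1 \<Longrightarrow> centered n a \<Longrightarrow> sym_psd n a \<Longrightarrow>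
           sphere_max n a \<le> K * cluster_max n k a v"
  shows "ereal K \<ge> 1 / ereal (C_const k b)"
proof -
  have bound: "(1 - 1 / m - 1 / sqrt m)\<^sup>2 \<le> K * C_const k b"
    if m: "k - 1 \<le> m" "4 \<le> m" for m :: nat
  proof -
    \<comment> \<open>Mesh \<open>1 / m\<close> makes the discretization error
      \<open>m / m = 1\<close>, small against \<open>sqrt m\<close>.\<close>
    obtain n f where nf: "m \<le> n" "f \<in> measurable (gauss m) (count_space UNIV)" "\<And>x. f x < n"
      "(\<integral>x. L2_set x {..<m} \<partial>gauss m) - m / m \<le> (\<Sum>p<n. L2_set (cell_moment m f p) {..<m})"
      using exists_cells[of m m] m by auto
    let ?c = "cell_moment m f"
    let ?a = "\<lambda>p q. inner_on m (?c p) (?c q)"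
    \<comment> \<open>For \<open>m \<ge> 4\<close> the value is at least
      \<open>1 - 1 / 4 - 1 / 2\<close>; nonnegativity lets the inequality between norms be
      squared.\<close>
    have half: "0 \<le> 1 - 1 / m - 1 / sqrt m"
    proof -
      have "2 \<le> sqrt m"
        using m by (intro real_le_rsqrt) simp
      then have "1 / sqrt m \<le> 1 / 2"
        using m by (intro divide_left_mono) auto
      moreover have "1 / real m \<le> 1 / 4"
        using m by (intro divide_left_mono) auto
      ultimately show ?thesis
        by simp
    qed
    have "sqrt m * (1 - 1 / m - 1 / sqrt m) = sqrt m * (1 - 1 / m) - m / m"
      using m by (simp add: algebra_simps)
    also have "\<dots> \<le> (\<Sum>p<n. L2_set (?c p) {..<m})"
      using integral_L2_set_gauss_ge[of m] nf(4) m by simp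
    finally have "(sqrt m * (1 - 1 / m - 1 / sqrt m))\<^sup>2 \<le> (\<Sum>p<n. L2_set (?c p) {..<m})\<^sup>2"
      using half by (intro power_mono) auto
    then have "(1 - 1 / m - 1 / sqrt m)\<^sup>2 \<le> (\<Sum>p<n. L2_set (?c p) {..<m})\<^sup>2 / m"
      using m by (simp add: power_mult_distrib pos_le_divide_eq mult.commute)
    also have "\<dots> \<le> sphere_max n ?a"
      using m nf by (intro sphere_max_gram_ge) auto
    \<comment> \<open>Here the hypothesis on \<open>K\<close> enters; the matrix is centered because
      the cell moments sum to zero.\<close>
    also have "\<dots> \<le> K * cluster_max n k ?a v"
      using m nf by (intro assms(5) centered_gram sym_psd_gram sum_cell_moment) auto
    also have "\<dots> \<le> K * C_const k b"
      using assms(4) nf m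
      by (intro mult_left_mono cluster_max_cell_moment_le assms(1,3)) auto
    finally show ?thesis .
  qed
  have "(\<lambda>m::nat. (1 - 1 / m - 1 / sqrt m)\<^sup>2) \<longlonglongrightarrow> (1 - 0 - 0)\<^sup>2"
    by (intro tendsto_power tendsto_diff tendsto_const lim_1_over_n tendsto_divide_0[OF tendsto_const]
        filterlim_at_top_imp_at_infinity filterlim_compose[OF sqrt_at_top filterlim_real_sequentially])
  moreover have "\<forall>\<^sub>F m in sequentially. (1 - 1 / real m - 1 / sqrt m)\<^sup>2 \<le> K * C_const k b"
    using eventually_ge_at_top[of "max (k - 1) 4"] by eventually_elim (rule bound; simp)
  ultimately have 1: "1 \<le> K * C_const k b"
    using tendsto_upperbound by fastforce
  \<comment> \<open>Positivity of C(B) follows from the limit inequality, so the quotient in the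
    extended reals is the real one.\<close>
  then have "C_const k b > 0"
    using assms(4) by (metis zero_less_mult_pos less_le_trans zero_less_one)
  with 1 have "1 / C_const k b \<le> K"
    by (simp add: divide_le_eq)
  moreover have "1 / ereal (C_const k b) = ereal (1 / C_const k b)"
    using \<open>C_const k b > 0\<close> by (simp add: one_ereal_def)
  ultimately show ?thesis
    by simp
qed

end
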